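(* (1) Let $f\colon\mathbb{C}\to\mathbb{C}$ be an SD map with $f(\mathbb{R})\subseteq\mathbb{R}$. Then $f(z)=z$ for all $z\in\mathbb{C}$, or $f(z)=\overline{z}$ for all $z\in\mathbb{C}$. (2) Let $\mathbb{E}$ be a Euclidean subfield of $\mathbb{R}$, let $\mathbb{F}\subseteq\mathbb{C}$ be the quadratic closure of $\mathbb{E}$, and let $f\colon\mathbb{F}\to\mathbb{F}$ be an SD map with $f(\mathbb{F}\cap\mathbb{R})\subseteq\mathbb{R}$. Then $f(z)=z$ for all $z\in\mathbb{F}$, or $f(z)=\overline{z}$ for all $z\in\mathbb{F}$.
   Context: An SD map on a field $\mathbb{F}$ is a function $f\colon \mathbb{F}\to\mathbb{F}$ such that for all $x \neq y$ in $\mathbb{F}$ one has $f(x)\neq f(y)$ and $f\left(\frac{x+y}{x-y}\right) = \frac{f(x)+f(y)}{f(x)-f(y)}$. A subfield of $\mathbb{R}$ (with the induced order) is Euclidean if every nonnegative element of it has a square root in it. The quadratic closure of $\mathbb{E}$ in $\mathbb{C}$ is the smallest subfield of $\mathbb{C}$ containing $\mathbb{E}$ in which every quadratic polynomial splits. *)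

theory Defs
  imports Complex_Main "HOL-Computational_Algebra.Computational_Algebra"
    "HOL-Algebra.Algebraic_Closure_Type"
begin

text \<open>Subfields of a field given by a type class, in the sense of HOL-Algebra.\<close>

abbreviation is_subfield :: "'a::field set \<Rightarrow> bool" where
  "is_subfield K \<equiv> subfield K (ring_of_type_algebra :: 'a ring)"

lemma is_subfield_iff:
  fixes K :: "'a::field set"
  shows "is_subfield K \<longleftrightarrow> 0 \<in> K \<and> 1 \<in> K \<and> (\<forall>x\<in>K. \<forall>y\<in>K. x + y \<in> K \<and> x * y \<in> K)
    \<and> (\<forall>x\<in>K. - x \<in> K \<and> inverse x \<in> K)"
proof -
  define R where "R = (ring_of_type_algebra :: 'a ring)"
  interpret R: field R
    unfolding R_def by (rule field_from_type_algebra)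
  have car: "carrier R = UNIV" and mu: "\<And>x y. x \<otimes>\<^bsub>R\<^esub> y = x * y"
    and ad: "\<And>x y. x \<oplus>\<^bsub>R\<^esub> y = x + y" and on: "\<one>\<^bsub>R\<^esub> = 1" and ze: "\<zero>\<^bsub>R\<^esub> = 0"
    by (simp_all add: R_def ring_of_type_algebra_def)
  have neg: "\<ominus>\<^bsub>R\<^esub> x = - x" for x
    by (rule R.minus_equality) (simp_all add: car ad ze)
  have inv: "inv\<^bsub>R\<^esub> x = inverse x" if "x \<noteq> 0" for x
    by (rule R.comm_inv_char) (use that in \<open>simp_all add: car mu on\<close>)
  show ?thesis
  proof
    assume "is_subfield K"
    then have sf: "subfield K R" by (simp add: R_def)
    note sr = subfieldE(1)[OF sf]
    have i: "inverse x \<in> K" if "x \<in> K" for x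
    proof (cases "x = 0")
      case False
      with that have "x \<in> K - {\<zero>\<^bsub>R\<^esub>}" by (simp add: ze)
      from R.subfield_m_inv(1)[OF sf this] show ?thesis
        using inv[OF False] by simp
    qed (use that in simp)
    show "0 \<in> K \<and> 1 \<in> K \<and> (\<forall>x\<in>K. \<forall>y\<in>K. x + y \<in> K \<and> x * y \<in> K)
      \<and> (\<forall>x\<in>K. - x \<in> K \<and> inverse x \<in> K)"
      using subringE[OF sr] i by (auto simp: ze on mu ad neg)
  next
    assume *: "0 \<in> K \<and> 1 \<in> K \<and> (\<forall>x\<in>K. \<forall>y\<in>K. x + y \<in> K \<and> x * y \<in> K)
      \<and> (\<forall>x\<in>K. - x \<in> K \<and> inverse x \<in> K)"
    have "subring K R"
      by (rule R.subringI) (use * in \<open>auto simp: car on neg mu ad\<close>)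
    then have "subcring K R"
      by (rule R.subcringI)
        (use * in \<open>auto simp: R.m_comm car\<close>)
    moreover have "Units (R\<lparr>carrier := K\<rparr>) = K - {\<zero>\<^bsub>R\<^esub>}"
    proof (intro equalityI subsetI)
      fix x assume "x \<in> K - {\<zero>\<^bsub>R\<^esub>}"
      then have "x \<in> K" "inverse x \<in> K" "x * inverse x = 1" "inverse x * x = 1"
        using * by (simp_all add: ze)
      then show "x \<in> Units (R\<lparr>carrier := K\<rparr>)"
        by (auto simp: Units_def mu on)
    qed (auto simp: Units_def mu on ze)
    ultimately have "subfield K R"
      by (rule R.subfieldI)
    then show "is_subfield K" by (simp add: R_def)
  qed
qed

definition SD_map_on :: "'a::field set \<Rightarrow> ('a \<Rightarrow> 'a) \<Rightarrow> bool" where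
  "SD_map_on F f \<longleftrightarrow> f \<in> F \<rightarrow> F \<and>
    (\<forall>x\<in>F. \<forall>y\<in>F. x \<noteq> y \<longrightarrow> f x \<noteq> f y \<and> f ((x + y) / (x - y)) = (f x + f y) / (f x - f y))"

definition euclidean_subfield :: "real set \<Rightarrow> bool" where
  "euclidean_subfield E \<longleftrightarrow> is_subfield E \<and> (\<forall>x\<in>E. 0 \<le> x \<longrightarrow> (\<exists>y\<in>E. y\<^sup>2 = x))"

definition quadratics_split :: "'a::field set \<Rightarrow> bool" where
  "quadratics_split K \<longleftrightarrow> (\<forall>a\<in>K. \<forall>b\<in>K. \<forall>c\<in>K. a \<noteq> 0 \<longrightarrow>
    (\<exists>r\<in>K. \<exists>s\<in>K. [:c, b, a:] = smult a ([:- r, 1:] * [:- s, 1:])))"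

definition quadratic_closure :: "real set \<Rightarrow> complex set" where
  "quadratic_closure E =
    \<Inter>{K. is_subfield K \<and> complex_of_real ` E \<subseteq> K \<and> quadratics_split K}"

lemma quadratics_split_UNIV: "quadratics_split (UNIV :: complex set)"
  unfolding quadratics_split_def
proof (intro ballI impI)
  fix a b c :: complex assume a: "a \<noteq> 0"
  define d where "d = csqrt (b\<^sup>2 - 4 * a * c)"
  have d: "d\<^sup>2 = b\<^sup>2 - 4 * a * c" by (simp add: d_def)
  have c: "c = (b\<^sup>2 - d\<^sup>2) / (4 * a)" using a d by simp
  have "[:c, b, a:] = smult a ([:- ((- b + d) / (2 * a)), 1:] * [:- ((- b - d) / (2 * a)), 1:])"
    using a by (simp add: c field_simps power2_eq_square)
  then show "\<exists>r\<in>UNIV. \<exists>s\<in>UNIV. [:c, b, a:] = smult a ([:- r, 1:] * [:- s, 1:])"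
    by blast
qed

text \<open>The intersection is indeed the smallest subfield with the required properties.\<close>

lemma quadratic_closure_least:
  shows "is_subfield (quadratic_closure E)"
    and "complex_of_real ` E \<subseteq> quadratic_closure E"
    and "quadratics_split (quadratic_closure E)"
    and "\<And>K. is_subfield K \<Longrightarrow> complex_of_real ` E \<subseteq> K \<Longrightarrow> quadratics_split K \<Longrightarrow>
           quadratic_closure E \<subseteq> K"
proof -
  show "is_subfield (quadratic_closure E)"
    unfolding quadratic_closure_def is_subfield_iff by blast
  show "complex_of_real ` E \<subseteq> quadratic_closure E"
    unfolding quadratic_closure_def by blast
  show "quadratic_closure E \<subseteq> K"
    if "is_subfield K" "complex_of_real ` E \<subseteq> K" "quadratics_split K" for K
    using that unfolding quadratic_closure_def by blast
  show "quadratics_split (quadratic_closure E)"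
    unfolding quadratics_split_def
  proof (intro ballI impI)
    fix a b c assume abc: "a \<in> quadratic_closure E" "b \<in> quadratic_closure E"
      "c \<in> quadratic_closure E" and a: "a \<noteq> 0"
    obtain r s where rs: "[:c, b, a:] = smult a ([:- r, 1:] * [:- s, 1:])"
      using quadratics_split_UNIV a unfolding quadratics_split_def by blast
    note ev = poly_smult poly_mult poly_pCons poly_0
    have root: "poly [:c, b, a:] x = 0 \<longleftrightarrow> x = r \<or> x = s" for x
      unfolding rs ev using a by simp
    have "r \<in> K \<and> s \<in> K"
      if K: "is_subfield K" "complex_of_real ` E \<subseteq> K" "quadratics_split K" for K
    proof -
      have "a \<in> K" "b \<in> K" "c \<in> K"
        using abc K unfolding quadratic_closure_def by blast+
      then obtain u v where uv: "u \<in> K" "v \<in> K" "[:c, b, a:] = smult a ([:- u, 1:] * [:- v, 1:])"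
        using K(3) a unfolding quadratics_split_def by blast
      have root': "poly [:c, b, a:] x = 0 \<longleftrightarrow> x = u \<or> x = v" for x
        unfolding uv(3) ev using a by simp
      show ?thesis using root root' uv(1,2) by metis
    qed
    then have "r \<in> quadratic_closure E" "s \<in> quadratic_closure E"
      unfolding quadratic_closure_def by blast+
    with rs show "\<exists>r\<in>quadratic_closure E. \<exists>s\<in>quadratic_closure E.
        [:c, b, a:] = smult a ([:- r, 1:] * [:- s, 1:])"
      by blast
  qed
qed

end

theory Submission
  imports Defs
begin

text \<open>An SD map \<open>f\<close> on a subfield fixes 0 and 1, and comparing the quotients for \<open>(t y, y)\<close> and
  \<open>(t, 1)\<close> shows that it is multiplicative. The values at 2, 3, 4, 5, 6 are then all expressed through
  \<open>f 2\<close>, which forces \<open>f 2 = 2\<close>, so \<open>f\<close> fixes the rationals. On the reals \<open>f\<close> preserves squares, hence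
  positivity, and the functional equation turns \<open>t > 1\<close>, i.e. \<open>(t + 1) / (t - 1) > 0\<close> for positive \<open>t\<close>,
  into \<open>f t > 1\<close>; so \<open>f\<close> is increasing and therefore the identity there. Finally \<open>f \<i> = \<plusminus>\<i>\<close>
  determines \<open>f\<close> on the imaginary axis, which the Cayley transform \<open>u \<mapsto> (u + 1) / (u - 1)\<close>
  links to the unit circle.\<close>

text \<open>The Cayley transform equals \<open>1 + 2 / (a - 1)\<close>, and 2 is nonzero in
  characteristic zero.\<close>

lemma cayley_inj:
  fixes a b :: "'a::field_char_0"
  assumes "(a + 1) / (a - 1) = (b + 1) / (b - 1)" "a \<noteq> 1" "b \<noteq> 1"
  shows "a = b"
proof -
  from assms have "(a + 1) * (b - 1) = (b + 1) * (a - 1)"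
    by (simp add: frac_eq_eq)
  then have "2 * a = 2 * b" by (simp add: algebra_simps)
  then show ?thesis by simp
qed

lemma Rats_of_real: "q \<in> \<rat> \<Longrightarrow> complex_of_real q \<in> \<rat>"
  by (elim Rats_cases') simp

section \<open>Algebra of SD maps: multiplicativity and values on the rationals\<close>

locale sd_map =
  fixes F :: "'a::field_char_0 set" and f :: "'a \<Rightarrow> 'a"
  assumes subfield: "is_subfield F" and sd: "SD_map_on F f"
begin

lemma closed [simp, intro]:
  "0 \<in> F" "1 \<in> F"
  "x \<in> F \<Longrightarrow> y \<in> F \<Longrightarrow> x + y \<in> F"
  "x \<in> F \<Longrightarrow> y \<in> F \<Longrightarrow> x * y \<in> F"
  "x \<in> F \<Longrightarrow> - x \<in> F"
  "x \<in> F \<Longrightarrow> inverse x \<in> F"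
  using subfield unfolding is_subfield_iff by blast+

lemma closed_diff [simp, intro]: "x \<in> F \<Longrightarrow> y \<in> F \<Longrightarrow> x - y \<in> F"
  using closed(3)[of x "- y"] by simp

lemma closed_divide [simp, intro]: "x \<in> F \<Longrightarrow> y \<in> F \<Longrightarrow> x / y \<in> F"
  by (simp add: divide_inverse)

lemma closed_of_nat [simp, intro]: "of_nat n \<in> F"
  by (induction n) auto

lemma closed_numeral [simp, intro]: "numeral n \<in> F"
  using closed_of_nat[of "numeral n"] by simp

lemma closed_of_int [simp, intro]: "of_int n \<in> F"
  by (cases n) (auto simp del: of_nat_Suc)

lemma closed_Rats: "x \<in> \<rat> \<Longrightarrow> x \<in> F"
  by (elim Rats_cases') auto

lemma inj: "x \<in> F \<Longrightarrow> y \<in> F \<Longrightarrow> f x = f y \<longleftrightarrow> x = y"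
  using sd unfolding SD_map_on_def by metis

lemma quotient:
  "x \<in> F \<Longrightarrow> y \<in> F \<Longrightarrow> x \<noteq> y \<Longrightarrow> f ((x + y) / (x - y)) = (f x + f y) / (f x - f y)"
  using sd unfolding SD_map_on_def by metis

text \<open>Taking \<open>y = 0\<close> makes the quotient 1 for every nonzero \<open>x\<close>, so
  \<open>(f 1 - 1) * f x\<close> is the same for all such \<open>x\<close>. Since \<open>f 1\<close>
  and \<open>f 2\<close> differ, \<open>f 1 = 1\<close>, and then \<open>2 * f 0\<close>
  vanishes.\<close>

lemma zero_one: "f 0 = 0 \<and> f 1 = 1"
proof -
  have eq: "(f 1 - 1) * f x = (f 1 + 1) * f 0" if "x \<in> F" "x \<noteq> 0" for x
  proof -
    have "f 1 = (f x + f 0) / (f x - f 0)"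
      using quotient[of x 0] that by simp
    moreover have "f x - f 0 \<noteq> 0" using inj[of x 0] that by simp
    ultimately have "f 1 * (f x - f 0) = f x + f 0" by simp
    then show ?thesis by (simp add: algebra_simps)
  qed
  have "(f 1 - 1) * f 1 = (f 1 - 1) * f 2"
    using eq[of 1] eq[of 2] by simp
  moreover have "f 1 \<noteq> f 2" using inj[of 1 2] by simp
  ultimately have "f 1 = 1" by simp
  with eq[of 1] show ?thesis by simp
qed

lemmas zero [simp] = zero_one[THEN conjunct1]
lemmas one [simp] = zero_one[THEN conjunct2]

lemma eq_zero_iff [simp]: "x \<in> F \<Longrightarrow> f x = 0 \<longleftrightarrow> x = 0"
  using inj[of x 0] by simp

lemma eq_one_iff [simp]: "x \<in> F \<Longrightarrow> f x = 1 \<longleftrightarrow> x = 1"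
  using inj[of x 1] by simp

text \<open>The pair \<open>(x, - x)\<close> has quotient 0, so the numerator
  \<open>f x + f (- x)\<close> must vanish.\<close>

lemma minus: "x \<in> F \<Longrightarrow> f (- x) = - f x"
proof (cases "x = 0")
  case False
  assume x: "x \<in> F"
  from False have "x \<noteq> - x" by (simp add: eq_neg_iff_add_eq_0 flip: mult_2)
  with x have "f x \<noteq> f (- x)" "0 = (f x + f (- x)) / (f x - f (- x))"
    using inj[of x "- x"] quotient[of x "- x"] by simp_all
  then have "f x + f (- x) = 0" by simp
  then show ?thesis by (simp add: eq_neg_iff_add_eq_0 add.commute)
qed simp

lemma cayley: "t \<in> F \<Longrightarrow> t \<noteq> 1 \<Longrightarrow> f ((t + 1) / (t - 1)) = (f t + 1) / (f t - 1)"
  using quotient[of t 1] by simp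

lemma mult:
  assumes "t \<in> F" "y \<in> F"
  shows "f (t * y) = f t * f y"
proof (cases "t = 1 \<or> y = 0")
  case False
  then have "t * y \<noteq> y" by simp
  have nz: "f y \<noteq> 0" "f t \<noteq> 1" "f (t * y) \<noteq> f y"
    using False assms inj[of "t * y" y] by auto
  have "(t * y + y) / (t * y - y) = (t + 1) / (t - 1)"
  proof -
    have "t * y + y = (t + 1) * y" "t * y - y = (t - 1) * y" by (simp_all add: algebra_simps)
    with False show ?thesis by simp
  qed
  then have "(f (t * y) + f y) / (f (t * y) - f y) = (f t + 1) / (f t - 1)"
    using quotient[of "t * y" y] cayley[of t] assms False by simp
  \<comment> \<open>Cancelling \<open>f y\<close> exhibits the left side as the Cayley transform of
    \<open>f (t * y) / f y\<close>, so that \<open>cayley_inj\<close> applies.\<close>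
  also have "(f (t * y) + f y) / (f (t * y) - f y)
      = (f (t * y) / f y + 1) / (f (t * y) / f y - 1)"
    using nz by (simp add: divide_simps)
  finally have "f (t * y) / f y = f t"
    by (rule cayley_inj) (use nz in auto)
  with nz show ?thesis by (simp add: field_simps)
qed auto

lemma inverse: "x \<in> F \<Longrightarrow> f (inverse x) = inverse (f x)"
  by (cases "x = 0") (use mult[of x "inverse x"] in \<open>auto intro!: inverse_unique[symmetric]\<close>)

lemma divide: "x \<in> F \<Longrightarrow> y \<in> F \<Longrightarrow> f (x / y) = f x / f y"
  by (simp add: divide_inverse mult inverse)

text \<open>Multiplicativity splits the left side of \<open>cayley\<close> into
  \<open>f (t + 1) / f (t - 1)\<close>. The cross-multiplied form includes \<open>t = 1\<close> and
  serves as a recursion on the integers.\<close>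

lemma shift:
  assumes "t \<in> F"
  shows "f (t + 1) * (f t - 1) = f (t - 1) * (f t + 1)"
proof (cases "t = 1")
  case False
  then have "f (t - 1) \<noteq> 0" "f t - 1 \<noteq> 0" using assms by auto
  moreover have "f (t + 1) / f (t - 1) = (f t + 1) / (f t - 1)"
    using cayley[of t] divide[of "t + 1" "t - 1"] False assms by simp
  ultimately show ?thesis by (simp add: frac_eq_eq mult.commute)
qed auto

text \<open>With \<open>f 4\<close> and \<open>f 6\<close> written as products, \<open>shift\<close>
  at 2, 4 and 5 gives three equations in \<open>f 2\<close>, \<open>f 3\<close>, \<open>f 5\<close>.
  Eliminating the last two leaves a polynomial equation for \<open>f 2\<close>.\<close>

lemma two: "f 2 = 2"
proof -
  define a b c where "a = f 2" and "b = f 3" and "c = f 5"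
  have nz: "a \<noteq> 0" "a \<noteq> 1" "c \<noteq> 0" "a \<noteq> - 1"
    using inj[of 2 "- 1"] by (simp_all add: a_def c_def minus)
  have f46: "f 4 = a * a" "f 6 = a * b"
    using mult[of 2 2] mult[of 2 3] by (simp_all add: a_def b_def)
  have e2: "b * (a - 1) = a + 1"
    using shift[of 2] by (simp add: a_def b_def)
  have e4: "c * (a * a - 1) = b * (a * a + 1)"
    using shift[of 4] by (simp add: f46 flip: b_def c_def)
  have "a * (b * (c - 1)) = a * (a * (c + 1))"
    using shift[of 5] by (simp add: f46 flip: c_def)
  with nz have e5: "b * (c - 1) = a * (c + 1)" by simp
  \<comment> \<open>The extra factor \<open>a - 1\<close> lets \<open>e2\<close> remove
    \<open>b\<close> from \<open>e4\<close>; below, the cube of \<open>a - 1\<close> does the same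
    for \<open>e5\<close> and clears the denominator of \<open>c\<close>.\<close>
  have "(a + 1) * (c * (a - 1) * (a - 1)) = (c * (a * a - 1)) * (a - 1)"
    by (simp add: algebra_simps)
  also have "\<dots> = (b * (a - 1)) * (a * a + 1)" unfolding e4 by (simp add: mult_ac)
  finally have "(a + 1) * (c * (a - 1) * (a - 1)) = (a + 1) * (a * a + 1)" unfolding e2 .
  moreover have "a + 1 \<noteq> 0" using nz by (simp add: eq_neg_iff_add_eq_0)
  ultimately have c: "c * (a - 1) * (a - 1) = a * a + 1" by simp
  have "(a + 1) * (c * (a - 1) * (a - 1) - (a - 1) * (a - 1))
      = b * (c - 1) * ((a - 1) * (a - 1) * (a - 1))"
    unfolding e2[symmetric] by (simp add: algebra_simps)
  also have "\<dots> = a * (a - 1) * (c * (a - 1) * (a - 1) + (a - 1) * (a - 1))"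
    unfolding e5 by (simp add: algebra_simps)
  finally have "2 * a * ((a - 2) * (a * a + 1)) = 0"
    unfolding c by (simp add: algebra_simps)
  \<comment> \<open>The field may contain a square root of -1, but by \<open>c\<close> the value
    \<open>a * a = - 1\<close> would force \<open>f 5 = 0\<close>.\<close>
  moreover have "a * a + 1 \<noteq> 0" using nz c by auto
  ultimately show ?thesis using nz by (simp add: a_def)
qed

lemma of_nat: "f (of_nat n) = of_nat n"
proof (induction n rule: less_induct)
  case (less n)
  \<comment> \<open>In \<open>shift\<close> at \<open>n - 1\<close> the factor of \<open>f n\<close>
    is \<open>n - 2\<close>, which can be cancelled only from 3 on; hence 2 is a base case.\<close>
  consider "n = 0" | "n = 1" | "n = 2" | m where "n = m + 2" "m \<ge> 1"
    by (metis One_nat_def add_2_eq_Suc' less_Suc_eq_le linorder_not_less not0_implies_Suc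
        numeral_2_eq_2 zero_less_Suc Suc_leI neq0_conv)
  then show ?case
  proof cases
    case (4 m)
    define t :: 'a where "t = of_nat (m + 1)"
    have t: "t + 1 = of_nat n" "t - 1 = of_nat m" by (simp_all add: t_def 4)
    have ft: "f t = t" unfolding t_def by (rule less) (simp add: 4)
    have fm: "f (t - 1) = t - 1" unfolding t(2) by (rule less) (simp add: 4)
    have "t \<in> F" by (simp add: t_def)
    from shift[OF this] have "f (t + 1) * (t - 1) = (t + 1) * (t - 1)"
      by (simp add: ft fm mult.commute)
    moreover have "t - 1 \<noteq> 0" using 4 by (simp add: t(2))
    ultimately show ?thesis by (simp add: t(1))
  qed (simp_all add: two)
qed

lemma of_int: "f (of_int k) = of_int k"
proof (cases k rule: int_cases2)
  case (nonneg n)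
  then show ?thesis by (simp add: of_nat)
next
  case (nonpos n)
  then show ?thesis by (simp add: of_nat minus)
qed

lemma Rats: "q \<in> \<rat> \<Longrightarrow> f q = q"
  by (elim Rats_cases') (simp add: divide of_int)

end

section \<open>Order and rigidity on the reals\<close>

locale real_sd_map = sd_map F f for F :: "complex set" and f +
  assumes reals: "\<And>x. complex_of_real x \<in> F \<Longrightarrow> f (complex_of_real x) \<in> \<real>"
    and sqrt_closed: "\<And>x. x \<ge> 0 \<Longrightarrow> complex_of_real x \<in> F \<Longrightarrow> complex_of_real (sqrt x) \<in> F"
begin

text \<open>Makes the order of the reals available; meaningful only where
  \<open>complex_of_real x\<close> lies in \<open>F\<close>, since there \<open>f\<close> takes real
  values.\<close>

definition g :: "real \<Rightarrow> real" where "g x = Re (f (complex_of_real x))"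

lemma f_of_real: "complex_of_real x \<in> F \<Longrightarrow> f (complex_of_real x) = complex_of_real (g x)"
  using reals by (simp add: g_def)

lemma g_pos:
  assumes "complex_of_real x \<in> F" "x > 0"
  shows "g x > 0"
proof -
  define s where "s = sqrt x"
  have s: "complex_of_real s \<in> F" "s \<noteq> 0" "x = s * s"
    using assms sqrt_closed[of x] by (auto simp: s_def)
  have "complex_of_real (g x) = complex_of_real (g s * g s)"
    using mult[OF s(1) s(1)] s f_of_real[OF s(1)] f_of_real[OF assms(1)] by simp
  then have "g x = g s * g s" by (simp only: of_real_eq_iff)
  moreover have "g s \<noteq> 0" using f_of_real[OF s(1)] s by auto
  ultimately show ?thesis by (metis not_real_square_gt_zero)
qed

lemma g_gt_one:
  assumes t: "complex_of_real t \<in> F" "t > 1"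
  shows "g t > 1"
proof -
  define u where "u = (t + 1) / (t - 1)"
  have u: "complex_of_real u = (complex_of_real t + 1) / (complex_of_real t - 1)"
    by (simp add: u_def)
  have uF: "complex_of_real u \<in> F" using t(1) unfolding u by auto
  have "complex_of_real (g u) = complex_of_real ((g t + 1) / (g t - 1))"
    using cayley[OF t(1)] t f_of_real[OF t(1)] f_of_real[OF uF] by (simp flip: u)
  then have "g u = (g t + 1) / (g t - 1)" by (simp only: of_real_eq_iff)
  moreover have "g u > 0" using uF t by (intro g_pos) (auto simp: u_def)
  moreover have "g t > 0" using t by (intro g_pos) auto
  ultimately show ?thesis by (auto simp: zero_less_divide_iff)
qed

text \<open>Multiplicativity reduces the comparison to \<open>y / x > 1\<close>.\<close>

lemma g_less:
  assumes "complex_of_real x \<in> F" "complex_of_real y \<in> F" "0 < x" "x < y"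
  shows "g x < g y"
proof -
  have q: "complex_of_real (y / x) \<in> F" using assms by auto
  have "complex_of_real (g (y / x)) = complex_of_real (g y / g x)"
    using divide[OF assms(2,1)] f_of_real[OF q] f_of_real assms(1,2) by simp
  then have "g (y / x) = g y / g x" by (simp only: of_real_eq_iff)
  moreover have "g (y / x) > 1" using q assms by (intro g_gt_one) auto
  moreover have "g x > 0" using assms by (intro g_pos)
  ultimately show ?thesis by simp
qed

text \<open>A rational strictly between \<open>x\<close> and \<open>g x\<close> would be fixed by
  \<open>g\<close> and so contradict monotonicity.\<close>

lemma g_pos_eq:
  assumes x: "complex_of_real x \<in> F" "x > 0"
  shows "g x = x"
proof -
  have q: "complex_of_real q \<in> F" "g q = q" if "q \<in> \<rat>" for q
    using Rats_of_real[OF that] by (auto simp: g_def Rats intro: closed_Rats)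
  show ?thesis
  proof (rule antisym)
    show "g x \<le> x"
    proof (rule ccontr)
      assume "\<not> g x \<le> x"
      then obtain r where "r \<in> \<rat>" "x < r" "r < g x"
        using Rats_dense_in_real[of x "g x"] by auto
      then show False using g_less[of x r] q[of r] x by auto
    qed
    show "x \<le> g x"
    proof (rule ccontr)
      assume "\<not> x \<le> g x"
      then obtain r where "r \<in> \<rat>" "g x < r" "r < x"
        using Rats_dense_in_real[of "g x" x] by auto
      \<comment> \<open>Positivity of \<open>r\<close>, required by \<open>g_less\<close>, comes
        from \<open>0 < g x < r\<close>.\<close>
      then show False using g_less[of r x] g_pos[of x] q[of r] x by auto
    qed
  qed
qed

lemma fix_real:
  assumes x: "complex_of_real x \<in> F"
  shows "f (complex_of_real x) = complex_of_real x"
proof -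
  have pos: "f (complex_of_real y) = complex_of_real y" if "complex_of_real y \<in> F" "y > 0" for y
    using that f_of_real g_pos_eq by simp
  consider "x = 0" | "x > 0" | "- x > 0" by linarith
  then show ?thesis
  proof cases
    case 3
    have "complex_of_real (- x) \<in> F" using x by auto
    with pos[of "- x"] 3 minus[OF x] show ?thesis by simp
  qed (use x pos in auto)
qed

section \<open>From the reals to the complex numbers\<close>

theorem identity_or_cnj:
  assumes ii: "\<i> \<in> F" and cnj: "\<And>z. z \<in> F \<Longrightarrow> cnj z \<in> F"
  shows "(\<forall>z\<in>F. f z = z) \<or> (\<forall>z\<in>F. f z = cnj z)"
proof -
  have "f \<i> * f \<i> = - 1"
    using mult[OF ii ii] minus[of 1] by simp
  then have "(f \<i> - \<i>) * (f \<i> + \<i>) = 0" by (simp add: algebra_simps)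
  then have fi: "f \<i> = \<i> \<or> f \<i> = - \<i>" by (auto simp: eq_neg_iff_add_eq_0)
  \<comment> \<open>The value at \<open>\<i>\<close> selects the candidate; both candidates are
    field automorphisms fixing the reals, so the two cases run in parallel.\<close>
  define h :: "complex \<Rightarrow> complex" where "h = (if f \<i> = \<i> then (\<lambda>z. z) else cnj)"
  have h_simps: "h (x + y) = h x + h y" "h (x - y) = h x - h y" "h (x * y) = h x * h y"
    "h (x / y) = h x / h y" "h 1 = 1" "h (complex_of_real r) = complex_of_real r"
    "h \<i> = f \<i>" "h x = 1 \<longleftrightarrow> x = 1"
    for x y r using fi by (auto simp: h_def)
  have imag: "f z = h z" if z: "z \<in> F" "Re z = 0" for z
  proof -
    have z_eq: "z = \<i> * complex_of_real (Im z)" using z by (simp add: complex_eq_iff)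
    have "complex_of_real (Im z) = - (\<i> * z)" using z by (simp add: complex_eq_iff)
    then have im: "complex_of_real (Im z) \<in> F" using ii z by auto
    show ?thesis
      by (subst (1 2) z_eq) (simp add: mult[OF ii im] fix_real[OF im] h_simps)
  qed
  have circle: "f u = h u" if u: "u \<in> F" "cmod u = 1" for u
  proof (cases "u = 1")
    case False
    \<comment> \<open>Conjugation inverts \<open>u\<close>, hence negates its Cayley transform,
      which is therefore purely imaginary and covered by \<open>imag\<close>.\<close>
    have "u * cnj u = 1" using u(2) by (simp add: complex_norm_square [symmetric])
    then have "(u + 1) * (cnj u - 1) + (cnj u + 1) * (u - 1) = 0"
      by (simp add: algebra_simps)
    moreover have "u - 1 \<noteq> 0" "cnj u - 1 \<noteq> 0" using False by auto
    ultimately have "(u + 1) / (u - 1) + cnj ((u + 1) / (u - 1)) = 0"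
      by (simp add: add_frac_eq mult.commute)
    then have "Re ((u + 1) / (u - 1)) = 0"
      unfolding complex_add_cnj by simp
    then have "f ((u + 1) / (u - 1)) = h ((u + 1) / (u - 1))"
      using u(1) by (intro imag) auto
    then have "(f u + 1) / (f u - 1) = (h u + 1) / (h u - 1)"
      using cayley[OF u(1) False] by (simp add: h_simps)
    then show ?thesis
      by (rule cayley_inj) (use False u(1) in \<open>auto simp: h_simps\<close>)
  qed (simp add: h_simps)
  have "f z = h z" if z: "z \<in> F" for z
  proof (cases "z = 0")
    case False
    define r where "r = cmod z"
    \<comment> \<open>Polar decomposition stays inside \<open>F\<close>: the squared modulus is
      \<open>z * cnj z\<close>, and its root is in \<open>F\<close> by
      \<open>sqrt_closed\<close>.\<close>
    have "complex_of_real (r\<^sup>2) \<in> F"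
      unfolding r_def complex_norm_square using z cnj by auto
    then have r: "complex_of_real r \<in> F"
      using sqrt_closed[of "r\<^sup>2"] by (simp add: r_def)
    define u where "u = z / complex_of_real r"
    have u: "u \<in> F" "cmod u = 1" "z = complex_of_real r * u"
      using z r False by (auto simp: u_def r_def norm_divide)
    show ?thesis
      unfolding u(3) by (simp add: mult[OF r u(1)] circle[OF u(1,2)] fix_real[OF r] h_simps)
  qed (use h_simps(6)[of 0] in simp)
  then show ?thesis by (cases "f \<i> = \<i>") (simp_all add: h_def)
qed

end

section \<open>Square roots and conjugation in the quadratic closure\<close>

lemma quadratics_split_sqrt:
  fixes K :: "'a::field set"
  assumes "is_subfield K" "quadratics_split K" "w\<^sup>2 \<in> K"
  shows "w \<in> K"
proof -
  have "0 \<in> K" "1 \<in> K" "- (w\<^sup>2) \<in> K"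
    using assms unfolding is_subfield_iff by blast+
  \<comment> \<open>The polynomial with roots \<open>w\<close> and \<open>- w\<close> splits over
    \<open>K\<close>, so \<open>w\<close> is one of its roots \<open>r\<close>, \<open>s\<close> in
    \<open>K\<close>.\<close>
  then obtain r s where rs: "r \<in> K" "s \<in> K"
    "[:- (w\<^sup>2), 0, 1:] = smult 1 ([:- r, 1:] * [:- s, 1:])"
    using assms(2) unfolding quadratics_split_def by (metis one_neq_zero)
  from arg_cong[OF rs(3), of "\<lambda>p. poly p w"] have "(w - r) * (w - s) = 0"
    by (simp add: power2_eq_square algebra_simps)
  with rs show ?thesis by auto
qed

lemma quadratics_split_cnj:
  assumes "quadratics_split K"
  shows "quadratics_split (cnj ` K)"
  unfolding quadratics_split_def
proof (intro ballI impI)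
  fix a b c assume "a \<in> cnj ` K" "b \<in> cnj ` K" "c \<in> cnj ` K" and "a \<noteq> 0"
  then obtain a' b' c' where K: "a' \<in> K" "b' \<in> K" "c' \<in> K"
    and abc: "a = cnj a'" "b = cnj b'" "c = cnj c'" and "a' \<noteq> 0" by auto
  then obtain r s where rs: "r \<in> K" "s \<in> K"
    and "[:c', b', a':] = smult a' ([:- r, 1:] * [:- s, 1:])"
    using assms unfolding quadratics_split_def by blast
  then have "[:c, b, a:] = smult a ([:- cnj r, 1:] * [:- cnj s, 1:])"
    by (simp add: abc)
  with rs show "\<exists>r\<in>cnj ` K. \<exists>s\<in>cnj ` K. [:c, b, a:] = smult a ([:- r, 1:] * [:- s, 1:])"
    by blast
qed

lemma is_subfield_cnj: "is_subfield K \<Longrightarrow> is_subfield (cnj ` K)"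
  unfolding is_subfield_iff
  by (auto simp: image_iff simp flip: complex_cnj_add complex_cnj_mult complex_cnj_minus
      complex_cnj_inverse intro: bexI[of _ 0] bexI[of _ 1])

lemma cnj_quadratic_closure:
  assumes "z \<in> quadratic_closure E"
  shows "cnj z \<in> quadratic_closure E"
  unfolding quadratic_closure_def
proof (rule InterI, clarify)
  fix K assume K: "is_subfield K" "complex_of_real ` E \<subseteq> K" "quadratics_split K"
  have "complex_of_real ` E \<subseteq> cnj ` K"
    using K(2) by (force simp: image_iff)
  with K have "quadratic_closure E \<subseteq> cnj ` K"
    by (intro quadratic_closure_least(4) is_subfield_cnj quadratics_split_cnj)
  with assms show "cnj z \<in> K" by auto
qed

text \<open>Common form of both assertions: the hypotheses on \<open>F\<close> hold for
  \<open>UNIV\<close> and for a quadratic closure.\<close>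

lemma SD_map_on_identity_or_cnj:
  fixes F :: "complex set"
  assumes F: "is_subfield F" "quadratics_split F" "\<And>z. z \<in> F \<Longrightarrow> cnj z \<in> F"
    and f: "SD_map_on F f" "f ` (F \<inter> \<real>) \<subseteq> \<real>"
  shows "(\<forall>z\<in>F. f z = z) \<or> (\<forall>z\<in>F. f z = cnj z)"
proof -
  note sqrt = quadratics_split_sqrt[OF F(1,2)]
  interpret sd_map F f by (rule sd_map.intro) (fact F f)+
  interpret real_sd_map F f
  proof unfold_locales
    show "complex_of_real (sqrt x) \<in> F" if "x \<ge> 0" "complex_of_real x \<in> F" for x
      by (rule sqrt) (use that in \<open>simp flip: of_real_power\<close>)
    show "f (complex_of_real x) \<in> \<real>" if "complex_of_real x \<in> F" for x
      using f(2) that by auto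
  qed
  have "\<i> \<in> F" by (rule sqrt) (use F(1) in \<open>simp add: is_subfield_iff\<close>)
  then show ?thesis using F(3) by (rule identity_or_cnj)
qed

theorem theorem1p2:
  shows "(\<forall>f :: complex \<Rightarrow> complex.
            SD_map_on UNIV f \<and> f ` \<real> \<subseteq> \<real> \<longrightarrow>
            (\<forall>z. f z = z) \<or> (\<forall>z. f z = cnj z))
       \<and> (\<forall>(E :: real set) (F :: complex set) (f :: complex \<Rightarrow> complex).
            euclidean_subfield E \<and> F = quadratic_closure E \<and>
            SD_map_on F f \<and> f ` (F \<inter> \<real>) \<subseteq> \<real> \<longrightarrow>
            (\<forall>z\<in>F. f z = z) \<or> (\<forall>z\<in>F. f z = cnj z))"
proof (intro conjI allI impI)
  fix f :: "complex \<Rightarrow> complex"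
  assume "SD_map_on UNIV f \<and> f ` \<real> \<subseteq> \<real>"
  moreover have "is_subfield (UNIV :: complex set)" by (simp add: is_subfield_iff)
  ultimately show "(\<forall>z. f z = z) \<or> (\<forall>z. f z = cnj z)"
    using SD_map_on_identity_or_cnj[of UNIV f] quadratics_split_UNIV by simp
next
  fix E F and f :: "complex \<Rightarrow> complex"
  assume "euclidean_subfield E \<and> F = quadratic_closure E \<and>
    SD_map_on F f \<and> f ` (F \<inter> \<real>) \<subseteq> \<real>"
  then show "(\<forall>z\<in>F. f z = z) \<or> (\<forall>z\<in>F. f z = cnj z)"
    using quadratic_closure_least(1,3) cnj_quadratic_closure
    by (intro SD_map_on_identity_or_cnj) auto
qed

end
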